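(* Let $\mathfrak{r}_{3,0}=\mathfrak{r}_2\times\mathbb{C}$ be the complex Lie algebra on $\mathbb{C}^3$ with canonical basis $\{e_1,e_2,e_3\}$ and only nonzero bracket (up to skew-symmetry) $[e_1,e_2]=e_2$. Any hom-Lie algebra $(\mathfrak{r}_2\times\mathbb{C},A)$ with $A$ a nilpotent operator is isomorphic to some hom-Lie algebra $\mathfrak{L}_6^i:=(\mathfrak{r}_2\times\mathbb{C},A_i)$, where $A_0$ is the zero map and the matrices of the other $A_i$ with respect to the ordered basis $\{e_1,e_2,e_3\}$ are $$A_1=\begin{pmatrix}0&0&0\\1&0&0\\0&0&0\end{pmatrix},\quad A_2=\begin{pmatrix}0&0&0\\0&0&0\\1&0&0\end{pmatrix},\quad A_3=\begin{pmatrix}0&0&0\\1&0&0\\1&0&0\end{pmatrix},$$ $$A_4=\begin{pmatrix}0&0&0\\0&0&1\\0&0&0\end{pmatrix},\quad A_5=\begin{pmatrix}0&0&0\\0&0&0\\0&1&0\end{pmatrix},\quad A_6(\lambda)=\begin{pmatrix}0&0&0\\0&\lambda&\lambda\\0&-\lambda&-\lambda\end{pmatrix},$$ $$A_7=\begin{pmatrix}0&0&0\\1&0&0\\0&1&0\end{pmatrix},\quad A_8=\begin{pmatrix}0&0&0\\0&0&1\\1&0&0\end{pmatrix},\quad A_9(\lambda)=\begin{pmatrix}0&0&0\\1&\lambda&\lambda\\0&-\lambda&-\lambda\end{pmatrix},$$ $$A_{10}=\begin{pmatrix}0&1&0\\0&0&0\\0&0&0\end{pmatrix},\quad A_{11}=\begin{pmatrix}0&1&0\\0&0&0\\1&0&0\end{pmatrix},\quad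 A_{12}=\begin{pmatrix}0&1&0\\0&0&1\\0&0&0\end{pmatrix},\quad A_{13}(\lambda)=\begin{pmatrix}0&1&0\\0&\lambda&\lambda\\0&-\lambda&-\lambda\end{pmatrix},$$ with $\lambda\in\mathbb{C}\setminus\{0\}$ in $A_6(\lambda)$, $A_9(\lambda)$ and $A_{13}(\lambda)$. Moreover, two hom-Lie algebras $(\mathfrak{r}_2\times\mathbb{C},A_i)$ and $(\mathfrak{r}_2\times\mathbb{C},A_j)$ in this list (including those with parameter $\lambda$) are isomorphic if and only if their twisting maps are equal, $A_i=A_j$.
   Context: A complex hom-Lie algebra is a triple $(V,\cdot,A)$, where $V$ is a complex vector space, $\cdot$ is a skew-symmetric bilinear product on $V$, and $A:V\to V$ is a linear map (the twisting map) satisfying the hom-Jacobi identity $$\sum_{\sigma\in S_3}\operatorname{sign}(\sigma)\,Ax_{\sigma(1)}\cdot(x_{\sigma(2)}\cdot x_{\sigma(3)})=0\quad\text{for all }x_1,x_2,x_3\in V.$$ For a Lie algebra $\mathfrak{g}$, a hom-Lie algebra $(\mathfrak{g},A)$ is one whose product is the Lie bracket of $\mathfrak{g}$. An isomorphism of hom-Lie algebras $(V,\cdot,A)\to(U,\ast,B)$ is an invertible linear map $g:V\to U$ with $g(x\cdot y)=(gx)\ast(gy)$ for all $x,y\in V$ and $g\circ A=B\circ g$. In the matrix of a linear map, the $j$-th column is the coordinate vector of the image of $e_j$. *)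

theory Defs
  imports "HOL-Analysis.Analysis"
begin

text \<open>The sum over \<open>S\<^sub>3\<close> in the hom-Jacobi identity is taken over the permutations of the index
  set \<open>{1, 2, 3}\<close>, and a triple of vectors is a function whose values at 1, 2, 3 matter.\<close>

locale hom_lie_algebra = vector_space scale
  for scale :: "complex \<Rightarrow> 'v::ab_group_add \<Rightarrow> 'v" +
  fixes product :: "'v \<Rightarrow> 'v \<Rightarrow> 'v" and twist :: "'v \<Rightarrow> 'v"
  assumes linear_product_left: "\<And>y. Vector_Spaces.linear scale scale (\<lambda>x. product x y)"
    and linear_product_right: "\<And>x. Vector_Spaces.linear scale scale (\<lambda>y. product x y)"
    and skew_symmetric: "\<And>x y. product x y = - product y x"
    and linear_twist: "Vector_Spaces.linear scale scale twist"
    and hom_jacobi: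
      "\<And>x :: nat \<Rightarrow> 'v. (\<Sum>\<sigma> | \<sigma> permutes {1, 2, 3}.
          scale (of_int (sign \<sigma>)) (product (twist (x (\<sigma> 1))) (product (x (\<sigma> 2)) (x (\<sigma> 3))))) = 0"

text \<open>The inverse of a bijective linear map is automatically linear.\<close>

definition hom_lie_isomorphism ::
  "(complex \<Rightarrow> 'v \<Rightarrow> 'v) \<Rightarrow> ('v \<Rightarrow> 'v \<Rightarrow> 'v) \<Rightarrow> ('v \<Rightarrow> 'v) \<Rightarrow>
   (complex \<Rightarrow> 'u \<Rightarrow> 'u) \<Rightarrow> ('u \<Rightarrow> 'u \<Rightarrow> 'u) \<Rightarrow> ('u \<Rightarrow> 'u) \<Rightarrow>
   ('v::ab_group_add \<Rightarrow> 'u::ab_group_add) \<Rightarrow> bool" where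
  "hom_lie_isomorphism scaleV productV A scaleU productU B g \<longleftrightarrow>
     hom_lie_algebra scaleV productV A \<and> hom_lie_algebra scaleU productU B \<and>
     Vector_Spaces.linear scaleV scaleU g \<and> bij g \<and>
     (\<forall>x y. g (productV x y) = productU (g x) (g y)) \<and>
     g \<circ> A = B \<circ> g"

definition hom_lie_isomorphic ::
  "(complex \<Rightarrow> 'v::ab_group_add \<Rightarrow> 'v) \<Rightarrow> ('v \<Rightarrow> 'v \<Rightarrow> 'v) \<Rightarrow> ('v \<Rightarrow> 'v) \<Rightarrow>
   (complex \<Rightarrow> 'u \<Rightarrow> 'u) \<Rightarrow> ('u \<Rightarrow> 'u \<Rightarrow> 'u) \<Rightarrow> ('u::ab_group_add \<Rightarrow> 'u) \<Rightarrow> bool" where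
  "hom_lie_isomorphic scaleV productV A scaleU productU B \<longleftrightarrow>
     (\<exists>g. hom_lie_isomorphism scaleV productV A scaleU productU B g)"

definition nilpotent_operator :: "('v::zero \<Rightarrow> 'v) \<Rightarrow> bool" where
  "nilpotent_operator A \<longleftrightarrow> (\<exists>k. A ^^ k = (\<lambda>x. 0))"

text \<open>The bracket of \<open>\<rr>\<^sub>2 \<times> \<complex>\<close>: the bilinear extension of \<open>[e\<^sub>1, e\<^sub>2] = e\<^sub>2 = - [e\<^sub>2, e\<^sub>1]\<close>
  and \<open>[e\<^sub>i, e\<^sub>j] = 0\<close> otherwise.\<close>

definition r2C_bracket :: "complex^3 \<Rightarrow> complex^3 \<Rightarrow> complex^3" where
  "r2C_bracket x y = (x $ 1 * y $ 2 - x $ 2 * y $ 1) *s axis 2 1"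

lemma r2C_bracket_basis:
  "r2C_bracket (axis 1 1) (axis 2 1) = axis 2 1"
  "r2C_bracket (axis 1 1) (axis 3 1) = 0"
  "r2C_bracket (axis 2 1) (axis 3 1) = 0"
  by (simp_all add: r2C_bracket_def axis_def vec_eq_iff)

text \<open>Hom-Lie algebras with the identity as twisting map are precisely Lie algebras.\<close>

lemma r2C_lie_algebra: "hom_lie_algebra (*s) r2C_bracket id"
proof unfold_locales
  fix x :: "nat \<Rightarrow> complex^3"
  show "(\<Sum>\<sigma> | \<sigma> permutes {1, 2, 3 :: nat}. of_int (sign \<sigma>) *s
      r2C_bracket (id (x (\<sigma> 1))) (r2C_bracket (x (\<sigma> 2)) (x (\<sigma> 3)))) = 0"
    by (simp add: sum_over_permutations_insert permutes_sing sign_swap_id sign_compose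
        permutation_swap_id r2C_bracket_def vec_eq_iff axis_def algebra_simps
        transpose_def sign_id)
qed (simp_all add: r2C_bracket_def vec_eq_iff algebra_simps)

text \<open>Matrices are lists of rows, so that \<open>(*v) M\<close> maps \<open>e\<^sub>j\<close> to the \<open>j\<close>-th column of \<open>M\<close>.
  The matrices \<open>A\<^sub>6(c)\<close>, \<open>A\<^sub>9(c)\<close> and \<open>A\<^sub>1\<^sub>3(c)\<close> form the last three families, the remaining
  \<open>A\<^sub>i\<close> are listed in increasing order of \<open>i\<close>.\<close>

definition L6_matrices :: "(complex^3^3) set" where
  "L6_matrices =
    {0,
     vector [vector [0, 0, 0], vector [1, 0, 0], vector [0, 0, 0]],
     vector [vector [0, 0, 0], vector [0, 0, 0], vector [1, 0, 0]],
     vector [vector [0, 0, 0], vector [1, 0, 0], vector [1, 0, 0]],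
     vector [vector [0, 0, 0], vector [0, 0, 1], vector [0, 0, 0]],
     vector [vector [0, 0, 0], vector [0, 0, 0], vector [0, 1, 0]],
     vector [vector [0, 0, 0], vector [1, 0, 0], vector [0, 1, 0]],
     vector [vector [0, 0, 0], vector [0, 0, 1], vector [1, 0, 0]],
     vector [vector [0, 1, 0], vector [0, 0, 0], vector [0, 0, 0]],
     vector [vector [0, 1, 0], vector [0, 0, 0], vector [1, 0, 0]],
     vector [vector [0, 1, 0], vector [0, 0, 1], vector [0, 0, 0]]} \<union>
    {vector [vector [0, 0, 0], vector [0, c, c], vector [0, - c, - c]] | c. c \<noteq> 0} \<union>
    {vector [vector [0, 0, 0], vector [1, c, c], vector [0, - c, - c]] | c. c \<noteq> 0} \<union>
    {vector [vector [0, 1, 0], vector [0, c, c], vector [0, - c, - c]] | c. c \<noteq> 0}"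

end

theory Submission
  imports Defs
begin

text \<open>A linear map \<open>A\<close> makes \<open>\<rr>\<^sub>2 \<times> \<complex>\<close> a hom-Lie algebra exactly when its matrix has
  \<open>A\<^sub>1\<^sub>3 = 0\<close>: since \<open>[x, y]\<close> is the 12-minor of \<open>(x, y)\<close> times \<open>e\<^sub>2\<close>, and \<open>[z, e\<^sub>2] = z\<^sub>1 e\<^sub>2\<close>, the
  hom-Jacobi sum is \<open>2 D e\<^sub>2\<close>, where \<open>D\<close> is the determinant of the matrix with rows
  \<open>((A x\<^sub>i)\<^sub>1, (x\<^sub>i)\<^sub>1, (x\<^sub>i)\<^sub>2)\<close>. It vanishes identically iff the functional \<open>(A x)\<^sub>1\<close> is a linear
  combination of the first two coordinates of \<open>x\<close>
  (\<open>hom_lie_algebra_r2C_iff\<close>).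

  The automorphisms of \<open>\<rr>\<^sub>2 \<times> \<complex>\<close> preserve the derived algebra \<open>\<complex>e\<^sub>2\<close> and the centre \<open>\<complex>e\<^sub>3\<close>, so they
  are \<open>e\<^sub>1 \<mapsto> e\<^sub>1 + a e\<^sub>2 + c e\<^sub>3\<close>, \<open>e\<^sub>2 \<mapsto> b e\<^sub>2\<close>, \<open>e\<^sub>3 \<mapsto> d e\<^sub>3\<close> with \<open>b, d \<noteq> 0\<close>
  (\<open>r2C_automorphism_iff\<close>). An isomorphism between two twisting maps is a conjugation by such a
  matrix \<open>G\<close>, and \<open>G M = N G\<close> amounts to eight scalar equations (\<open>isomorphic_iff_entries\<close>).
  The problem is thereby one about tuples of eight complex numbers.

  A nilpotent \<open>3 \<times> 3\<close> matrix has characteristic polynomial \<open>x\<^sup>3\<close>; its three lower coefficients give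
  three equations for the entries (\<open>nilpotent_coefficients_zero\<close>). If \<open>A\<^sub>1\<^sub>2 = 0\<close>, then \<open>A\<^sub>1\<^sub>1 = 0\<close> and the lower right block is a nilpotent
  \<open>2 \<times> 2\<close> matrix acted on by \<open>diag(b, d)\<close>; the remaining parameters then normalize the first column.
  If \<open>A\<^sub>1\<^sub>2 \<noteq> 0\<close>, then \<open>a\<close> and \<open>b\<close> are forced by the first row \<open>(0, 1, 0)\<close>, and \<open>c\<close>, \<open>d\<close>
  normalize the third row and the entry 23 (\<open>L6_representative_exists\<close>).

  For uniqueness, the first row of a listed matrix is \<open>0\<close> or \<open>(0, 1, 0)\<close>, and the eight equations show
  that isomorphic listed matrices agree in this row, then in the entry 22 (which is the parameter \<open>\<lambda>\<close>
  where there is one), and then in the positions of their zeros, which determine the other entries (\<open>L6_isomorphic_imp_eq\<close>).\<close>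

section \<open>Twisting maps and automorphisms of the Lie algebra\<close>

lemma hom_lie_algebra_r2C_iff: "hom_lie_algebra (*s) r2C_bracket ((*v) M) \<longleftrightarrow> M $ 1 $ 3 = 0"
proof
  assume "hom_lie_algebra (*s) r2C_bracket ((*v) M)"
  then interpret hom_lie_algebra "(*s)" r2C_bracket "(*v) M" .
  \<comment> \<open>The identity at the basis \<open>(e\<^sub>1, e\<^sub>2, e\<^sub>3)\<close>: only \<open>[A e\<^sub>3, [e\<^sub>1, e\<^sub>2]]\<close> can be nonzero, as
    \<open>e\<^sub>3\<close> is central.\<close>
  define x :: "nat \<Rightarrow> complex^3" where
    "x i = (if i = 1 then axis 1 1 else if i = 2 then axis 2 1 else axis 3 1)" for i
  have "(\<Sum>\<sigma> | \<sigma> permutes {1, 2, 3 :: nat}. of_int (sign \<sigma>) *s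
      r2C_bracket (M *v (x (\<sigma> 1))) (r2C_bracket (x (\<sigma> 2)) (x (\<sigma> 3)))) $ 2 = 0"
    using hom_jacobi[of x] by simp
  then show "M $ 1 $ 3 = 0"
    by (simp add: sum_over_permutations_insert permutes_sing sign_swap_id sign_compose
        permutation_swap_id r2C_bracket_def axis_def x_def matrix_vector_mult_def sum_3
        transpose_def sign_id)
next
  assume "M $ 1 $ 3 = 0"
  then show "hom_lie_algebra (*s) r2C_bracket ((*v) M)"
    by unfold_locales
      (simp_all add: r2C_bracket_def vec_eq_iff algebra_simps matrix_vector_mult_def sum.distrib
        sum_distrib_left forall_3 sum_over_permutations_insert permutes_sing sign_swap_id
        sign_compose permutation_swap_id axis_def sum_3 transpose_def sign_id)
qed

definition r2C_automorphism_matrix ::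
  "complex \<Rightarrow> complex \<Rightarrow> complex \<Rightarrow> complex \<Rightarrow> complex^3^3" where
  "r2C_automorphism_matrix a b c d = vector [vector [1, 0, 0], vector [a, b, 0], vector [c, 0, d]]"

lemma r2C_automorphism_iff:
  "bij ((*v) G) \<and> (\<forall>x y. G *v r2C_bracket x y = r2C_bracket (G *v x) (G *v y)) \<longleftrightarrow>
    (\<exists>a b c d. b \<noteq> 0 \<and> d \<noteq> 0 \<and> G = r2C_automorphism_matrix a b c d)" (is "?L \<longleftrightarrow> ?R")
proof
  assume L: ?L
  have preserves: "G *v r2C_bracket (axis i 1) (axis j 1) =
      r2C_bracket (G *v axis i 1) (G *v axis j 1)"
    for i j using L by blast
  have nz: "G *v axis j 1 \<noteq> 0" for j
    using L by (metis axis_eq_0_iff bij_is_inj injD matrix_vector_mult_0_right zero_neq_one)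
  \<comment> \<open>Applying \<open>G\<close> to \<open>[e\<^sub>1, e\<^sub>2] = e\<^sub>2\<close>: the image of \<open>e\<^sub>2\<close> is a bracket, hence a multiple of \<open>e\<^sub>2\<close>,
    and comparing the factors gives \<open>G\<^sub>1\<^sub>1 = 1\<close>.\<close>
  have G12: "G $ 1 $ 2 = 0" and G32: "G $ 3 $ 2 = 0"
    using preserves[of 1 2]
    by (simp_all add: r2C_bracket_def vec_eq_iff forall_3 axis_def matrix_vector_mult_def sum_3)
  moreover from this have "G $ 2 $ 2 = G $ 1 $ 1 * G $ 2 $ 2"
    using arg_cong[OF preserves[of 1 2], of "\<lambda>v. v $ 2"]
    by (simp add: r2C_bracket_def axis_def matrix_vector_mult_def sum_3)
  moreover from G12 G32 have "G $ 2 $ 2 \<noteq> 0"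
    using nz[of 2] by (simp add: vec_eq_iff forall_3 axis_def matrix_vector_mult_def sum_3)
  ultimately have e2: "G $ 1 $ 2 = 0" "G $ 3 $ 2 = 0" "G $ 2 $ 2 \<noteq> 0" "G $ 1 $ 1 = 1"
    by simp_all
  \<comment> \<open>The image of the central vector \<open>e\<^sub>3\<close> commutes with those of \<open>e\<^sub>2\<close> and \<open>e\<^sub>1\<close>.\<close>
  from e2 have "G $ 1 $ 3 = 0"
    using preserves[of 2 3]
    by (simp add: r2C_bracket_def vec_eq_iff forall_3 axis_def matrix_vector_mult_def sum_3)
  moreover from this have "G $ 2 $ 3 = 0"
    using preserves[of 1 3] e2
    by (simp add: r2C_bracket_def vec_eq_iff forall_3 axis_def matrix_vector_mult_def sum_3)
  ultimately have e3: "G $ 1 $ 3 = 0" "G $ 2 $ 3 = 0" "G $ 3 $ 3 \<noteq> 0"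
    using nz[of 3] by (auto simp add: vec_eq_iff forall_3 axis_def matrix_vector_mult_def sum_3)
  show ?R
    by (rule exI[of _ "G $ 2 $ 1"], rule exI[of _ "G $ 2 $ 2"], rule exI[of _ "G $ 3 $ 1"],
        rule exI[of _ "G $ 3 $ 3"])
      (use e2 e3 in \<open>simp add: r2C_automorphism_matrix_def vec_eq_iff forall_3\<close>)
next
  assume ?R
  then obtain a b c d where G: "b \<noteq> 0" "d \<noteq> 0" "G = r2C_automorphism_matrix a b c d"
    by blast
  then have "det G \<noteq> 0"
    by (simp add: r2C_automorphism_matrix_def det_3)
  then have "bij ((*v) G)"
    by (simp add: invertible_det_nz flip: invertible_eq_bij)
  moreover have "G *v r2C_bracket x y = r2C_bracket (G *v x) (G *v y)" for x y
    unfolding G(3) by (simp add: r2C_automorphism_matrix_def r2C_bracket_def vec_eq_iff forall_3 axis_def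
        matrix_vector_mult_def sum_3 algebra_simps)
  ultimately show ?L
    by blast
qed

lemma isomorphic_iff_conjugate:
  assumes "M $ 1 $ 3 = 0" and "N $ 1 $ 3 = 0"
  shows "hom_lie_isomorphic (*s) r2C_bracket ((*v) M) (*s) r2C_bracket ((*v) N) \<longleftrightarrow>
    (\<exists>a b c d. b \<noteq> 0 \<and> d \<noteq> 0 \<and>
      r2C_automorphism_matrix a b c d ** M = N ** r2C_automorphism_matrix a b c d)"
    (is "?L \<longleftrightarrow> ?R")
proof
  assume ?L
  then obtain g where lin: "Vector_Spaces.linear (*s) (*s) g" and g: "bij g"
      "\<And>x y. g (r2C_bracket x y) = r2C_bracket (g x) (g y)" "g \<circ> (*v) M = (*v) N \<circ> g"
    unfolding hom_lie_isomorphic_def hom_lie_isomorphism_def by blast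
  define G where "G = matrix g"
  have gG: "g = (*v) G"
    using lin by (auto simp: G_def matrix_works)
  then have "G ** M = N ** G"
    using fun_cong[OF g(3)] by (simp add: matrix_eq matrix_vector_mul_assoc)
  moreover obtain a b c d where "b \<noteq> 0" "d \<noteq> 0" "G = r2C_automorphism_matrix a b c d"
    using r2C_automorphism_iff[of G] g(1,2) unfolding gG by blast
  ultimately show ?R by blast
next
  assume ?R
  then obtain a b c d where nz: "b \<noteq> 0" "d \<noteq> 0"
    and comm: "r2C_automorphism_matrix a b c d ** M = N ** r2C_automorphism_matrix a b c d"
    by blast
  define G where "G = r2C_automorphism_matrix a b c d"
  have "(*v) G \<circ> (*v) M = (*v) N \<circ> (*v) G"
    using comm by (auto simp: matrix_vector_mul_assoc G_def)
  moreover have "bij ((*v) G)" "\<forall>x y. G *v r2C_bracket x y = r2C_bracket (G *v x) (G *v y)"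
    using r2C_automorphism_iff[of G] nz G_def by blast+
  ultimately show ?L
    unfolding hom_lie_isomorphic_def hom_lie_isomorphism_def
    using assms hom_lie_algebra_r2C_iff matrix_vector_mul_linear_gen by blast
qed

text \<open>The zero in position 13 is the hom-Jacobi identity, so these are the matrices of all twisting maps.\<close>

definition twist_matrix ::
  "complex \<Rightarrow> complex \<Rightarrow> complex \<Rightarrow> complex \<Rightarrow> complex \<Rightarrow> complex \<Rightarrow> complex \<Rightarrow> complex \<Rightarrow> complex^3^3"
  where "twist_matrix p q r s t u v w =
    vector [vector [p, q, 0], vector [r, s, t], vector [u, v, w]]"

lemma hom_lie_algebra_r2C_iff_twist_matrix: "hom_lie_algebra (*s) r2C_bracket ((*v) M) \<longleftrightarrow>
    (\<exists>p q r s t u v w. M = twist_matrix p q r s t u v w)"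
  by (simp add: hom_lie_algebra_r2C_iff twist_matrix_def vec_eq_iff forall_3)

text \<open>The equations are the entries of \<open>G M = N G\<close>, where \<open>G\<close> is the automorphism with parameters
  \<open>a, b, c, d\<close>; the factor \<open>d\<close> is cancelled in the entry 33, and the entry 13 is trivial.\<close>

lemma isomorphic_iff_entries:
  "hom_lie_isomorphic (*s) r2C_bracket ((*v) (twist_matrix p q r s t u v w))
      (*s) r2C_bracket ((*v) (twist_matrix p' q' r' s' t' u' v' w')) \<longleftrightarrow>
    (\<exists>a b c d. b \<noteq> 0 \<and> d \<noteq> 0 \<and>
      p = p' + q' * a \<and> q = q' * b \<and>
      a * p + b * r = r' + s' * a + t' * c \<and> a * q + b * s = s' * b \<and> b * t = t' * d \<and>
      c * p + d * u = u' + v' * a + w' * c \<and> c * q + d * v = v' * b \<and> w = w')"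
    (is "_ \<longleftrightarrow> ?R")
proof -
  have entries: "r2C_automorphism_matrix a b c d ** twist_matrix p q r s t u v w =
      twist_matrix p' q' r' s' t' u' v' w' ** r2C_automorphism_matrix a b c d \<longleftrightarrow>
      p = p' + q' * a \<and> q = q' * b \<and>
      a * p + b * r = r' + s' * a + t' * c \<and> a * q + b * s = s' * b \<and> b * t = t' * d \<and>
      c * p + d * u = u' + v' * a + w' * c \<and> c * q + d * v = v' * b \<and> w = w'"
    if "d \<noteq> 0" for a b c d
    using that by (simp add: r2C_automorphism_matrix_def twist_matrix_def vec_eq_iff forall_3
        matrix_matrix_mult_def sum_3)
  have "twist_matrix p q r s t u v w $ 1 $ 3 = 0"
    and "twist_matrix p' q' r' s' t' u' v' w' $ 1 $ 3 = 0"
    by (simp_all add: twist_matrix_def)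
  note isomorphic_iff_conjugate[OF this]
  also have "(\<exists>a b c d. b \<noteq> 0 \<and> d \<noteq> 0 \<and>
      r2C_automorphism_matrix a b c d ** twist_matrix p q r s t u v w =
      twist_matrix p' q' r' s' t' u' v' w' ** r2C_automorphism_matrix a b c d) \<longleftrightarrow> ?R"
    by (intro ex_cong1 conj_cong refl entries)
  finally show ?thesis .
qed

section \<open>The characteristic polynomial of a nilpotent matrix\<close>

lemma nilpotent_imp_eigenvalue_zero:
  fixes M :: "complex^'n^'n"
  assumes nil: "nilpotent_operator ((*v) M)" and det: "det (mat z - M) = 0"
  shows "z = 0"
proof -
  obtain x where x: "(mat z - M) *v x = 0" "x \<noteq> 0"
    using det by (metis invertible_det_nz invertible_left_inverse matrix_left_invertible_ker)
  have "mat z *v x = z *s x"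
    by (simp add: vec_eq_iff matrix_vector_mult_def mat_def if_distrib if_distribR cong: if_cong)
  with x have "M *v x = z *s x"
    by (simp add: matrix_vector_mult_diff_rdistrib)
  then have "((*v) M ^^ k) x = z ^ k *s x" for k
    by (induction k) (simp_all add: matrix_vector_mult_scaleR vec.scale mult.commute)
  moreover obtain k where "(*v) M ^^ k = (\<lambda>x. 0)"
    using nil by (auto simp: nilpotent_operator_def)
  ultimately have "z ^ k *s x = 0"
    by metis
  with x show ?thesis by simp
qed

lemma nilpotent_imp_det_zero:
  fixes M :: "complex^'n^'n"
  assumes "nilpotent_operator ((*v) M)"
  shows "det M = 0"
proof (rule ccontr)
  assume "det M \<noteq> 0"
  then have "inj ((*v) M)"
    by (metis invertible_det_nz invertible_eq_bij bij_is_inj)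
  then have "inj ((*v) M ^^ k)" for k
    by (rule inj_fn)
  then have "inj (\<lambda>x::complex^'n. 0 :: complex^'n)"
    using assms unfolding nilpotent_operator_def by metis
  then have "(1 :: complex^'n) = 0"
    by (rule injD) simp
  then show False by simp
qed

lemma quadratic_coefficients_zero:
  fixes t m :: complex
  assumes root: "\<And>z. z\<^sup>2 - t * z + m = 0 \<Longrightarrow> z = 0"
  shows "t = 0" and "m = 0"
proof -
  define s where "s = csqrt (t\<^sup>2 - 4 * m)"
  have s: "s\<^sup>2 = t\<^sup>2 - 4 * m"
    by (simp add: s_def)
  \<comment> \<open>Completing the square: the two roots are \<open>(t \<plusminus> s) / 2\<close>.\<close>
  have zero: "z = 0" if "(2 * z - t)\<^sup>2 = s\<^sup>2" for z
  proof (rule root)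
    have "4 * (z\<^sup>2 - t * z + m) = (2 * z - t)\<^sup>2 - s\<^sup>2"
      unfolding s by (simp add: algebra_simps power2_eq_square)
    with that show "z\<^sup>2 - t * z + m = 0"
      by (metis diff_self mult_eq_0_iff zero_neq_numeral)
  qed
  have "(t + s) / 2 = 0" "(t - s) / 2 = 0"
    by (rule zero, simp add: field_simps power2_commute)+
  then have "t + s = 0" "t = s"
    by simp_all
  then have "2 * s = 0"
    by simp
  with \<open>t = s\<close> have "t = 0" "s = 0"
    by simp_all
  with s show "t = 0" "m = 0"
    by auto
qed

text \<open>The three expressions are the trace, the sum of the principal 2-minors and the determinant, that is,
  up to sign, the coefficients of the characteristic polynomial. As the determinant vanishes, this
  polynomial is \<open>z\<close> times a quadratic, whose roots are eigenvalues and hence zero.\<close>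

lemma nilpotent_coefficients_zero:
  assumes "nilpotent_operator ((*v) (twist_matrix p q r s t u v w))"
    (is "nilpotent_operator ((*v) ?M)")
  shows "p + s + w = 0" (is "?t = 0") and "p * s - q * r + p * w + s * w - t * v = 0" (is "?m = 0")
    and "p * s * w + q * t * u - q * r * w - p * t * v = 0"
proof -
  have "det ?M = 0"
    using assms by (rule nilpotent_imp_det_zero)
  then show "p * s * w + q * t * u - q * r * w - p * t * v = 0"
    by (simp add: twist_matrix_def det_3 algebra_simps)
  have root: "z = 0" if "z\<^sup>2 - ?t * z + ?m = 0" for z
  proof -
    have "det (mat z - ?M) = z * (z\<^sup>2 - ?t * z + ?m) - det ?M"
      by (simp add: twist_matrix_def det_3 mat_def algebra_simps power2_eq_square)
    with that \<open>det ?M = 0\<close> show "z = 0"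
      using nilpotent_imp_eigenvalue_zero[OF assms] by simp
  qed
  show "?t = 0"
    by (rule quadratic_coefficients_zero(1)[OF root])
  show "?m = 0"
    by (rule quadratic_coefficients_zero(2)[OF root])
qed

section \<open>The list of normal forms\<close>

text \<open>The list is sorted by the first row and then by the lower right block; the first
  column comes last.\<close>

lemma twist_matrix_in_L6_iff: "twist_matrix p q r s t u v w \<in> L6_matrices \<longleftrightarrow> p = 0 \<and>
    (q = 0 \<and>
       (s = 0 \<and> t = 0 \<and> v = 0 \<and> w = 0 \<and> r \<in> {0, 1} \<and> u \<in> {0, 1} \<or>
        s = 0 \<and> t = 1 \<and> v = 0 \<and> w = 0 \<and> r = 0 \<and> u \<in> {0, 1} \<or>
        s = 0 \<and> t = 0 \<and> v = 1 \<and> w = 0 \<and> r \<in> {0, 1} \<and> u = 0 \<or>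
        s \<noteq> 0 \<and> t = s \<and> v = - s \<and> w = - s \<and> r \<in> {0, 1} \<and> u = 0) \<or>
     q = 1 \<and> r = 0 \<and>
       (s = 0 \<and> t = 0 \<and> v = 0 \<and> w = 0 \<and> u \<in> {0, 1} \<or>
        s = 0 \<and> t = 1 \<and> v = 0 \<and> w = 0 \<and> u = 0 \<or>
        s \<noteq> 0 \<and> t = s \<and> v = - s \<and> w = - s \<and> u = 0))"
  unfolding L6_matrices_def twist_matrix_def by (simp add: vec_eq_iff forall_3) argo

lemma L6_is_twist_matrix:
  assumes "M \<in> L6_matrices"
  obtains p q r s t u v w where "M = twist_matrix p q r s t u v w"
proof -
  have "M $ 1 $ 3 = 0"
    using assms by (auto simp: L6_matrices_def)
  then show ?thesis
    using that hom_lie_algebra_r2C_iff hom_lie_algebra_r2C_iff_twist_matrix by blast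
qed

text \<open>The properties of a listed matrix by which its entries can be recovered from the vanishing of some of
  them.\<close>

lemma twist_matrix_in_L6_D:
  assumes "twist_matrix p q r s t u v w \<in> L6_matrices"
  shows "p = 0" "q \<in> {0, 1}" "w = - s" "r \<in> {0, 1}" "u \<in> {0, 1}"
    and "s \<noteq> 0 \<Longrightarrow> t = s" "s \<noteq> 0 \<Longrightarrow> v = - s" "s \<noteq> 0 \<Longrightarrow> u = 0"
    and "s = 0 \<Longrightarrow> t \<in> {0, 1}" "s = 0 \<Longrightarrow> v \<in> {0, 1}"
    and "s = 0 \<Longrightarrow> t \<noteq> 0 \<Longrightarrow> r = 0" "v \<noteq> 0 \<Longrightarrow> u = 0"
    and "q \<noteq> 0 \<Longrightarrow> r = 0" "q \<noteq> 0 \<Longrightarrow> s = 0 \<Longrightarrow> v = 0"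
  using assms unfolding twist_matrix_in_L6_iff by (elim conjE disjE; simp)+

section \<open>Listed twisting maps are pairwise non-isomorphic\<close>

lemma L6_isomorphic_imp_eq:
  assumes M: "twist_matrix p q r s t u v w \<in> L6_matrices"
    and N: "twist_matrix p' q' r' s' t' u' v' w' \<in> L6_matrices"
    and iso: "hom_lie_isomorphic (*s) r2C_bracket ((*v) (twist_matrix p q r s t u v w))
      (*s) r2C_bracket ((*v) (twist_matrix p' q' r' s' t' u' v' w'))"
  shows "twist_matrix p q r s t u v w = twist_matrix p' q' r' s' t' u' v' w'"
proof -
  note M = twist_matrix_in_L6_D[OF M] and N = twist_matrix_in_L6_D[OF N]
  obtain a b c d where nz: "b \<noteq> 0" "d \<noteq> 0" and eqs:
      "p = p' + q' * a" "q = q' * b"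
      "a * p + b * r = r' + s' * a + t' * c" "a * q + b * s = s' * b" "b * t = t' * d"
      "c * p + d * u = u' + v' * a + w' * c" "c * q + d * v = v' * b"
    using iso unfolding isomorphic_iff_entries by blast
  have p: "p = 0" "p' = 0" using M(1) N(1) by auto
  have q: "q' = q"
    using M(2) N(2) nz eqs(2) by auto
  have s: "s' = s"
    using p q nz eqs(1,4) by auto
  have w: "w = - s" "w' = - s"
    using M(3) N(3) s by simp_all
  have t: "t' = t"
    using M(6,9) N(6,9) s nz eqs(5) by (cases "s = 0") auto
  have v: "v' = v"
  proof (cases "s = 0 \<and> q = 0")
    case True
    then show ?thesis
      using M(10) N(10) s nz eqs(7) by auto
  next
    case False
    then show ?thesis
      using M(7,14) N(7,14) s q by (cases "s = 0") auto
  qed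
  \<comment> \<open>Up to the factor \<open>b\<close>, conjugation changes the entry 21 by \<open>s a + t c\<close>. This vanishes if \<open>s = t = 0\<close>, and
    also if \<open>s \<noteq> 0\<close>, when the equation for the entry 31 reads \<open>0 = - s (a + c)\<close>. Elsewhere the
    entry 21 of a listed matrix is zero.\<close>
  have "r' = r"
  proof (cases "q = 0 \<and> (s \<noteq> 0 \<or> t = 0)")
    case True
    have "s * a + t * c = 0"
    proof (cases "s = 0")
      case False
      then have "s * (a + c) = 0"
        using eqs(6) M(7,8) N(8) p s v w by (simp add: algebra_simps)
      with False show ?thesis
        using M(6) by (simp add: algebra_simps)
    qed (use True in simp)
    then have "b * r = r'"
      using eqs(3) p s t by (simp add: add.assoc)
    then show ?thesis
      using M(4) N(4) nz by auto
  next
    case False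
    then show ?thesis
      using M(11,13) N(11,13) s t q by auto
  qed
  moreover have "u' = u"
  proof (cases "v = 0")
    case True
    then have "s = 0" using M(7) by auto
    then have "d * u = u'"
      using eqs(6) p v w True by simp
    then show ?thesis
      using M(5) N(5) nz by auto
  next
    case False
    then show ?thesis
      using M(12) N(12) v by simp
  qed
  ultimately show ?thesis
    using p q s t v w by simp
qed

section \<open>Every nilpotent twisting map has a listed representative\<close>

lemma exists_unit_scaling: "\<exists>k. k \<noteq> 0 \<and> k * x \<in> {0, 1 :: complex}"
proof (cases "x = 0")
  case True
  then have "(1 :: complex) \<noteq> 0 \<and> 1 * x \<in> {0, 1}" by simp
  then show ?thesis ..
next
  case False
  then have "1 / x \<noteq> 0 \<and> 1 / x * x \<in> {0, 1}" by simp
  then show ?thesis ..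
qed

text \<open>The hypotheses say that the characteristic polynomial is \<open>x\<^sup>3\<close>. They determine the normalized
  matrix: after the free parameters have been spent on some of its entries, the others come out
  as in the list.\<close>

lemma L6_representative_exists:
  assumes tr: "p + s + w = 0" and m: "p * s - q * r + p * w + s * w - t * v = 0"
    and det: "p * s * w + q * t * u - q * r * w - p * t * v = 0"
  shows "\<exists>N\<in>L6_matrices. hom_lie_isomorphic (*s) r2C_bracket
    ((*v) (twist_matrix p q r s t u v w)) (*s) r2C_bracket ((*v) N)"
proof -
  have I: ?thesis if "twist_matrix p' q' r' s' t' u' v' w' \<in> L6_matrices" "b \<noteq> 0" "d \<noteq> 0"
      "p = p' + q' * a" "q = q' * b"
      "a * p + b * r = r' + s' * a + t' * c" "a * q + b * s = s' * b" "b * t = t' * d"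
      "c * p + d * u = u' + v' * a + w' * c" "c * q + d * v = v' * b" "w = w'"
    for a b c d p' q' r' s' t' u' v' w'
    using that by (intro bexI[OF _ that(1)] isomorphic_iff_entries[THEN iffD2] exI[of _ a] exI[of _ b]
        exI[of _ c] exI[of _ d] conjI)
  \<comment> \<open>Each case names the listed matrix and the automorphism; \<open>I[OF _ _ _, of a c]\<close> receives \<open>b\<close> and
    \<open>d\<close> from the facts that they are nonzero.\<close>
  have w: "w = - (p + s)"
    using tr by (simp add: add_eq_0_iff2 add.commute)
  show ?thesis
  proof (cases "q = 0")
    case q: True
    have "p * p * p = 0"
      using m det w q by algebra
    then have p: "p = 0" by simp
    have tv: "t * v = - (s * s)"
      using m p q w by algebra
    show ?thesis
    proof (cases "s = 0")
      case s: True
      with p w have "w = 0" by simp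
      consider "t = 0" "v = 0" | "t \<noteq> 0" "v = 0" | "t = 0" "v \<noteq> 0"
        using tv s by auto
      then show ?thesis
      proof cases
        case 1
        obtain b d where "b \<noteq> 0" "b * r \<in> {0, 1}" "d \<noteq> 0" "d * u \<in> {0, 1}"
          using exists_unit_scaling by meson
        then have "twist_matrix 0 0 (b * r) 0 0 (d * u) 0 0 \<in> L6_matrices"
          unfolding twist_matrix_in_L6_iff by blast
        from I[OF this \<open>b \<noteq> 0\<close> \<open>d \<noteq> 0\<close>, of 0 0] show ?thesis
          by (simp add: 1 p q s \<open>w = 0\<close>)
      next
        case 2
        obtain d where d: "d \<noteq> 0" "d * u \<in> {0, 1}"
          using exists_unit_scaling by meson
        then have mem: "twist_matrix 0 0 0 0 1 (d * u) 0 0 \<in> L6_matrices"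
          unfolding twist_matrix_in_L6_iff by blast
        have "d / t \<noteq> 0"
          using d 2 by simp
        from I[OF mem this \<open>d \<noteq> 0\<close>, of 0 "d / t * r"] show ?thesis
          by (simp add: 2 p q s \<open>w = 0\<close>)
      next
        case 3
        obtain b where b: "b \<noteq> 0" "b * r \<in> {0, 1}"
          using exists_unit_scaling by meson
        then have mem: "twist_matrix 0 0 (b * r) 0 0 0 1 0 \<in> L6_matrices"
          unfolding twist_matrix_in_L6_iff by blast
        have "b / v \<noteq> 0"
          using b 3 by simp
        from I[OF mem \<open>b \<noteq> 0\<close> this, of "b / v * u" 0] show ?thesis
          by (simp add: 3 p q s \<open>w = 0\<close>)
      qed
    next
      case s: False
      then have t: "t \<noteq> 0" using tv by auto
      \<comment> \<open>Making the upper row of the block \<open>(s, s)\<close> fixes the ratio \<open>b : d = s : t\<close>. With \<open>a = 0\<close>, the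
        condition that the entry 31 become zero determines \<open>c\<close>, and the common factor \<open>k\<close> normalizes
        the entry 21.\<close>
      obtain k where k: "k \<noteq> 0" "k * (s * r + t * u) \<in> {0, 1}"
        using exists_unit_scaling by meson
      then have mem: "twist_matrix 0 0 (k * (s * r + t * u)) s s 0 (- s) (- s) \<in> L6_matrices"
        using s unfolding twist_matrix_in_L6_iff by blast
      have nz: "k * s \<noteq> 0" "k * t \<noteq> 0"
        using k s t by simp_all
      have "k * t * v = - s * (k * s)"
        using tv by algebra
      with I[OF mem nz, of 0 "- (k * t * u) / s"] show ?thesis
        using s w by (simp add: p q algebra_simps)
    qed
  next
    case q: False
    \<comment> \<open>The first row becomes \<open>(0, 1, 0)\<close> for \<open>a = p\<close> and \<open>b = q\<close> only; then the entry 22 becomes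
      \<open>p + s\<close>, and \<open>c\<close> is determined, in terms of \<open>d\<close>, by the prescribed value \<open>0\<close> or \<open>- (p + s)\<close> of the
      entry 32.\<close>
    show ?thesis
    proof (cases "p + s = 0")
      case ps: True
      have w0: "w = 0"
        using w ps by simp
      have s: "s = - p"
        using ps by (simp add: eq_neg_iff_add_eq_0 add.commute)
      show ?thesis
      proof (cases "t = 0")
        case t: True
        obtain k where k: "k \<noteq> 0" "k * (q * u - p * v) \<in> {0, 1}"
          using exists_unit_scaling by meson
        then have mem: "twist_matrix 0 1 0 0 0 (k * (q * u - p * v)) 0 0 \<in> L6_matrices"
          unfolding twist_matrix_in_L6_iff by blast
        have "k * q \<noteq> 0"
          using k q by simp
        have "p * p + q * r = 0"
          using m s t w0 by algebra
        with I[OF mem q \<open>k * q \<noteq> 0\<close>, of p "- k * v"] show ?thesis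
          by (simp add: s t w0 algebra_simps)
      next
        case t: False
        have mem: "twist_matrix 0 1 0 0 1 0 0 0 \<in> L6_matrices"
          unfolding twist_matrix_in_L6_iff by blast
        have "q * t \<noteq> 0"
          using q t by simp
        have "p * p + q * r = - (t * v)"
          using m s w0 by algebra
        moreover have "t * (q * u - p * v) = 0"
          using det s w0 by algebra
        then have "q * u = p * v"
          using t by simp
        then have "- t * v * p + q * t * u = 0"
          by algebra
        ultimately show ?thesis
          using I[OF mem q \<open>q * t \<noteq> 0\<close>, of p "- t * v"] by (simp add: s w0 algebra_simps)
      qed
    next
      case ps: False
      define z where "z = p + s"
      have z: "z \<noteq> 0" "s = z - p" "w = - z"
        using ps w by (simp_all add: z_def)
      have t: "t \<noteq> 0"
      proof
        assume "t = 0"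
        \<comment> \<open>For \<open>t = 0\<close> the entry \<open>w = - z\<close> is an eigenvalue.\<close>
        then have "z * z * z = 0"
          using m det z(2,3) by algebra
        with z show False by simp
      qed
      define c where "c = - z - t * v / z"
      define d where "d = q * t / z"
      have cz: "c * z = - z * z - t * v" and dz: "d * z = q * t"
        using z(1) by (simp_all add: c_def d_def field_simps)
      have "d \<noteq> 0"
        using q t z(1) by (simp add: d_def)
      have mem: "twist_matrix 0 1 0 z z 0 (- z) (- z) \<in> L6_matrices"
        using z(1) by (simp add: twist_matrix_in_L6_iff)
      have "p * p + q * r = z * p + z * c"
        using m z(2,3) cz by algebra
      moreover have "z * (c * p + d * u) = z * (- z * p + - z * c)"
        using m det z(2,3) cz dz by algebra
      then have "c * p + d * u = - z * p + - z * c"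
        using z(1) mult_left_cancel by blast
      moreover have "z * (c * q + d * v) = z * (- z * q)"
        using cz dz by algebra
      then have "c * q + d * v = - z * q"
        using z(1) mult_left_cancel by blast
      moreover have "p * q + q * s = z * q"
        using z(2) by algebra
      moreover have "q * t = z * d"
        using dz by algebra
      ultimately show ?thesis
        by (intro I[OF mem q \<open>d \<noteq> 0\<close>, of p c]) (simp_all add: z(3))
    qed
  qed
qed

section \<open>The classification\<close>

theorem proposition3p8:
  shows "(\<forall>M\<in>L6_matrices. hom_lie_algebra (*s) r2C_bracket ((*v) M)) \<and>
    (\<forall>A. hom_lie_algebra (*s) r2C_bracket A \<and> nilpotent_operator A \<longrightarrow>
       (\<exists>M\<in>L6_matrices. hom_lie_isomorphic (*s) r2C_bracket A (*s) r2C_bracket ((*v) M))) \<and>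
    (\<forall>M\<in>L6_matrices. \<forall>N\<in>L6_matrices.
       hom_lie_isomorphic (*s) r2C_bracket ((*v) M) (*s) r2C_bracket ((*v) N) \<longleftrightarrow>
       (*v) M = (*v) N)"
proof (intro conjI ballI allI impI)
  fix M :: "complex^3^3"
  assume "M \<in> L6_matrices"
  then show "hom_lie_algebra (*s) r2C_bracket ((*v) M)"
    using L6_is_twist_matrix hom_lie_algebra_r2C_iff_twist_matrix by metis
next
  fix A :: "complex^3 \<Rightarrow> complex^3"
  assume A: "hom_lie_algebra (*s) r2C_bracket A \<and> nilpotent_operator A"
  then have "(*v) (matrix A) = A"
    using hom_lie_algebra.linear_twist by (blast intro: matrix_works)
  moreover from this obtain p q r s t u v w where "matrix A = twist_matrix p q r s t u v w"
    using A hom_lie_algebra_r2C_iff_twist_matrix by metis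
  ultimately have A_eq: "A = (*v) (twist_matrix p q r s t u v w)"
    by simp
  show "\<exists>M\<in>L6_matrices. hom_lie_isomorphic (*s) r2C_bracket A (*s) r2C_bracket ((*v) M)"
    using A nilpotent_coefficients_zero[of p q r s t u v w] L6_representative_exists
    unfolding A_eq by blast
next
  fix M N :: "complex^3^3"
  assume M: "M \<in> L6_matrices" and N: "N \<in> L6_matrices"
  show "hom_lie_isomorphic (*s) r2C_bracket ((*v) M) (*s) r2C_bracket ((*v) N) \<longleftrightarrow> (*v) M = (*v) N"
  proof
    assume "hom_lie_isomorphic (*s) r2C_bracket ((*v) M) (*s) r2C_bracket ((*v) N)"
    then show "(*v) M = (*v) N"
      using M N L6_isomorphic_imp_eq by (metis L6_is_twist_matrix)
  next
    assume eq: "(*v) M = (*v) N"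
    have M13: "M $ 1 $ 3 = 0"
      using M by (auto simp: L6_matrices_def)
    \<comment> \<open>The identity matrix is the automorphism with \<open>a = c = 0\<close> and \<open>b = d = 1\<close>.\<close>
    have "r2C_automorphism_matrix 0 1 0 1 ** M = M ** r2C_automorphism_matrix 0 1 0 1"
      by (simp add: r2C_automorphism_matrix_def vec_eq_iff forall_3 matrix_matrix_mult_def sum_3)
    then show "hom_lie_isomorphic (*s) r2C_bracket ((*v) M) (*s) r2C_bracket ((*v) N)"
      unfolding eq[symmetric] isomorphic_iff_conjugate[OF M13 M13]
      using zero_neq_one by metis
  qed
qed

end
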